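(* Let $B \subseteq A$ be a regular inclusion of $C^*$-algebras satisfying the regular ideal intersection property, and let $N \subseteq \mathcal{N}(A,B)$ be a $*$-semigroup of normalizers with dense span in $A$. Assume further that there is an $N$-invariant faithful conditional expectation $E \colon A \to B$. Then the invariant regular ideals of $B$ form a Boolean algebra. Moreover, the map $J \mapsto J\cap B$, with inverse given by $K \mapsto J_K := \{a \in A : E(a^*a) \in K\}$, is a Boolean algebra isomorphism between the regular ideals of $A$ and the invariant regular ideals of $B$.
   Context: Ideals are closed and two-sided. For $X \subseteq A$, $X^\perp = \{a\in A : ax = xa = 0 \text{ for all } x\in X\}$; for $X\subseteq B$, $X^{\perp_B} = X^\perp\cap B$. An ideal $J$ of $A$ is regular if $J = J^{\perp\perp}$; an ideal $K$ of $B$ is regular if $K = (K^{\perp_B})^{\perp_B}$. The regular ideals of a $C^*$-algebra form a Boolean algebra with $J\wedge K = J\cap K$, $J \vee K = \langle J\cup K\rangle^{\perp\perp}$ (where $\langle X\rangle$ is the ideal generated by $X$) and $\lnot J = J^\perp$; the Boolean operations on invariant regular ideals of $B$ are the restrictions of those on the regular ideals of $B$. An inclusion of $C^*$-algebras $B\subseteq A$ means that $B$ is a $C^*$-subalgebra of $A$ containing an approximate unit for $A$. A normalizer of $B$ is an element $n\in A$ with $nBn^*\subseteq B$ and $n^*Bn\subseteq B$; $\mathcal{N}(A,B)$ is the set of all normalizers. The inclusion is regular if $\mathcal{N}(A,B)$ has dense linear span in $A$. An ideal $K$ of $B$ is invariant if $nKn^*\subseteq K$ for all $n\in\mathcal{N}(A,B)$.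 A conditional expectation $E\colon A\to B$ is $N$-invariant if $nE(a)n^* = E(nan^* )$ for all $a\in A$ and $n\in N$; it is faithful if $E(a^*a)=0$ implies $a=0$. The inclusion has the regular ideal intersection property if $J\cap B\neq\{0\}$ for every non-zero regular ideal $J$ of $A$. *)

theory Defs
  imports "HOL-Analysis.Analysis"
begin

section \<open>C*-algebras\<close>

text \<open>C*-algebras are not assumed to be unital, and may be zero. The class
  \<^class>\<open>real_normed_algebra\<close> supplies the algebra structure and the submultiplicative norm,
  \<^class>\<open>banach\<close> completeness.\<close>

class cstar_algebra = real_normed_algebra + banach +
  fixes scaleC :: "complex \<Rightarrow> 'a \<Rightarrow> 'a"  (infixr \<open>*\<^sub>C\<close> 75)
    and star :: "'a \<Rightarrow> 'a"
  assumes scaleC_add_right: "c *\<^sub>C (x + y) = c *\<^sub>C x + c *\<^sub>C y"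
    and scaleC_add_left: "(c + d) *\<^sub>C x = c *\<^sub>C x + d *\<^sub>C x"
    and scaleC_scaleC: "c *\<^sub>C (d *\<^sub>C x) = (c * d) *\<^sub>C x"
    and scaleR_scaleC: "r *\<^sub>R x = complex_of_real r *\<^sub>C x"
    and norm_scaleC: "norm (c *\<^sub>C x) = cmod c * norm x"
    and mult_scaleC_left: "(c *\<^sub>C x) * y = c *\<^sub>C (x * y)"
    and mult_scaleC_right: "x * (c *\<^sub>C y) = c *\<^sub>C (x * y)"
    and star_star: "star (star x) = x"
    and star_add: "star (x + y) = star x + star y"
    and star_scaleC: "star (c *\<^sub>C x) = cnj c *\<^sub>C star x"
    and star_mult: "star (x * y) = star y * star x"
    and norm_star_mult_self: "norm (star x * x) = (norm x)\<^sup>2"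

global_interpretation complex_vector:
  vector_space "scaleC :: complex \<Rightarrow> 'a \<Rightarrow> 'a::cstar_algebra"
  defines csubspace = complex_vector.subspace
    and cspan = complex_vector.span
proof
  fix x :: 'a
  show "1 *\<^sub>C x = x"
    using scaleR_scaleC[of 1 x] by simp
qed (simp_all add: scaleC_add_right scaleC_add_left scaleC_scaleC)

definition cstar_subalgebra :: "'a::cstar_algebra set \<Rightarrow> bool" where
  "cstar_subalgebra B \<longleftrightarrow> csubspace B \<and> closed B \<and>
     (\<forall>x\<in>B. \<forall>y\<in>B. x * y \<in> B) \<and> (\<forall>x\<in>B. star x \<in> B)"

text \<open>Below, the first argument \<open>B\<close> of a predicate or operation is the C*-algebra relative to
  which it is understood: either a C*-subalgebra, or \<^term>\<open>UNIV\<close> for the ambient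
  C*-algebra itself.\<close>

definition positive_in :: "'a::cstar_algebra set \<Rightarrow> 'a \<Rightarrow> bool" where
  "positive_in B a \<longleftrightarrow> (\<exists>x\<in>B. a = star x * x)"

section \<open>Regular ideals\<close>

definition ideal_in :: "'a::cstar_algebra set \<Rightarrow> 'a set \<Rightarrow> bool" where
  "ideal_in B J \<longleftrightarrow> J \<subseteq> B \<and> csubspace J \<and> closed J \<and>
     (\<forall>b\<in>B. \<forall>x\<in>J. b * x \<in> J \<and> x * b \<in> J)"

definition ideal_generated_in :: "'a::cstar_algebra set \<Rightarrow> 'a set \<Rightarrow> 'a set" where
  "ideal_generated_in B X = \<Inter> {J. ideal_in B J \<and> X \<subseteq> J}"

definition annihilator :: "'a::cstar_algebra set \<Rightarrow> 'a set" where
  "annihilator X = {a. \<forall>x\<in>X. a * x = 0 \<and> x * a = 0}"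

definition annihilator_in :: "'a::cstar_algebra set \<Rightarrow> 'a set \<Rightarrow> 'a set" where
  "annihilator_in B X = annihilator X \<inter> B"

definition regular_ideal_in :: "'a::cstar_algebra set \<Rightarrow> 'a set \<Rightarrow> bool" where
  "regular_ideal_in B J \<longleftrightarrow> ideal_in B J \<and> J = annihilator_in B (annihilator_in B J)"

section \<open>Inclusions, normalizers and conditional expectations\<close>

text \<open>Nets are encoded as proper filters on the algebra (the filter of sets containing a tail of
  the net). An approximate unit consists of positive contractions; monotonicity of the
  net is not demanded, so that the hypothesis below covers both common conventions.\<close>

definition contains_approximate_unit :: "'a::cstar_algebra set \<Rightarrow> bool" where
  "contains_approximate_unit B \<longleftrightarrow>
     (\<exists>F. F \<noteq> bot \<and> (\<forall>\<^sub>F e in F. e \<in> B \<and> positive_in B e \<and> norm e \<le> 1) \<and>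
       (\<forall>a. ((\<lambda>e. e * a) \<longlongrightarrow> a) F \<and> ((\<lambda>e. a * e) \<longlongrightarrow> a) F))"

definition cstar_inclusion :: "'a::cstar_algebra set \<Rightarrow> bool" where
  "cstar_inclusion B \<longleftrightarrow> cstar_subalgebra B \<and> contains_approximate_unit B"

definition normalizers :: "'a::cstar_algebra set \<Rightarrow> 'a set" where
  "normalizers B = {n. \<forall>b\<in>B. n * b * star n \<in> B \<and> star n * b * n \<in> B}"

definition regular_inclusion :: "'a::cstar_algebra set \<Rightarrow> bool" where
  "regular_inclusion B \<longleftrightarrow> cstar_inclusion B \<and> closure (cspan (normalizers B)) = UNIV"

definition regular_ideal_intersection_property :: "'a::cstar_algebra set \<Rightarrow> bool" where
  "regular_ideal_intersection_property B \<longleftrightarrow>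
     (\<forall>J. regular_ideal_in UNIV J \<and> J \<noteq> {0} \<longrightarrow> J \<inter> B \<noteq> {0})"

definition star_semigroup :: "'a::cstar_algebra set \<Rightarrow> bool" where
  "star_semigroup N \<longleftrightarrow> (\<forall>m\<in>N. \<forall>n\<in>N. m * n \<in> N) \<and> (\<forall>n\<in>N. star n \<in> N)"

definition invariant_ideal :: "'a::cstar_algebra set \<Rightarrow> 'a set \<Rightarrow> bool" where
  "invariant_ideal B K \<longleftrightarrow> ideal_in B K \<and> (\<forall>n\<in>normalizers B. \<forall>k\<in>K. n * k * star n \<in> K)"

text \<open>Complete positivity is not listed: it follows from positivity and the bimodule property.\<close>

definition conditional_expectation :: "'a::cstar_algebra set \<Rightarrow> ('a \<Rightarrow> 'a) \<Rightarrow> bool" where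
  "conditional_expectation B E \<longleftrightarrow>
     (\<forall>x y. E (x + y) = E x + E y) \<and> (\<forall>c x. E (c *\<^sub>C x) = c *\<^sub>C E x) \<and>
     (\<forall>a. E a \<in> B) \<and> (\<forall>b\<in>B. E b = b) \<and>
     (\<forall>a. \<forall>b\<in>B. E (b * a) = b * E a \<and> E (a * b) = E a * b) \<and>
     (\<forall>a. norm (E a) \<le> norm a) \<and>
     (\<forall>a. positive_in UNIV a \<longrightarrow> positive_in B (E a))"

definition faithful_expectation :: "('a::cstar_algebra \<Rightarrow> 'a) \<Rightarrow> bool" where
  "faithful_expectation E \<longleftrightarrow> (\<forall>a. E (star a * a) = 0 \<longrightarrow> a = 0)"

definition invariant_expectation :: "'a::cstar_algebra set \<Rightarrow> ('a \<Rightarrow> 'a) \<Rightarrow> bool" where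
  "invariant_expectation N E \<longleftrightarrow> (\<forall>n\<in>N. \<forall>a. n * E a * star n = E (n * a * star n))"

definition expectation_ideal :: "('a::cstar_algebra \<Rightarrow> 'a) \<Rightarrow> 'a set \<Rightarrow> 'a set" where
  "expectation_ideal E K = {a. E (star a * a) \<in> K}"

section \<open>Boolean algebras of regular ideals\<close>

text \<open>The library's Boolean algebras live on whole types; here the carrier is a set.\<close>

record 'b boolalg =
  carrier :: "'b set"
  meet :: "'b \<Rightarrow> 'b \<Rightarrow> 'b"
  join :: "'b \<Rightarrow> 'b \<Rightarrow> 'b"
  compl :: "'b \<Rightarrow> 'b"
  bottom :: 'b
  top_el :: 'b

definition is_boolean_algebra :: "'b boolalg \<Rightarrow> bool" where
  "is_boolean_algebra L \<longleftrightarrow>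
     bottom L \<in> carrier L \<and> top_el L \<in> carrier L \<and>
     (\<forall>x\<in>carrier L. compl L x \<in> carrier L \<and>
        meet L x (compl L x) = bottom L \<and> join L x (compl L x) = top_el L \<and>
        meet L x (top_el L) = x \<and> join L x (bottom L) = x) \<and>
     (\<forall>x\<in>carrier L. \<forall>y\<in>carrier L.
        meet L x y \<in> carrier L \<and> join L x y \<in> carrier L \<and>
        meet L x y = meet L y x \<and> join L x y = join L y x \<and>
        meet L x (join L x y) = x \<and> join L x (meet L x y) = x) \<and>
     (\<forall>x\<in>carrier L. \<forall>y\<in>carrier L. \<forall>z\<in>carrier L.
        meet L (meet L x y) z = meet L x (meet L y z) \<and>
        join L (join L x y) z = join L x (join L y z) \<and>
        meet L x (join L y z) = join L (meet L x y) (meet L x z) \<and>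
        join L x (meet L y z) = meet L (join L x y) (join L x z))"

definition boolean_algebra_isomorphism ::
    "'b boolalg \<Rightarrow> 'c boolalg \<Rightarrow> ('b \<Rightarrow> 'c) \<Rightarrow> bool" where
  "boolean_algebra_isomorphism L M f \<longleftrightarrow>
     is_boolean_algebra L \<and> is_boolean_algebra M \<and>
     bij_betw f (carrier L) (carrier M) \<and>
     (\<forall>x\<in>carrier L. \<forall>y\<in>carrier L.
        f (meet L x y) = meet M (f x) (f y) \<and> f (join L x y) = join M (f x) (f y)) \<and>
     (\<forall>x\<in>carrier L. f (compl L x) = compl M (f x)) \<and>
     f (bottom L) = bottom M \<and> f (top_el L) = top_el M"

definition regular_ideal_algebra :: "'a::cstar_algebra set \<Rightarrow> 'a set boolalg" where
  "regular_ideal_algebra B =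
     \<lparr>carrier = {J. regular_ideal_in B J},
      meet = (\<lambda>J K. J \<inter> K),
      join = (\<lambda>J K. annihilator_in B (annihilator_in B (ideal_generated_in B (J \<union> K)))),
      compl = annihilator_in B,
      bottom = {0},
      top_el = B\<rparr>"

definition invariant_regular_ideal_algebra :: "'a::cstar_algebra set \<Rightarrow> 'a set boolalg" where
  "invariant_regular_ideal_algebra B =
     (regular_ideal_algebra B)
       \<lparr>carrier := {K. regular_ideal_in B K \<and> invariant_ideal B K}\<rparr>"

end

theory Submission
  imports Defs
begin

text \<open>Since \<open>E\<close> is faithful and \<open>B\<close>-linear, \<open>E(a\<^sup>*a)k = 0\<close> holds for \<open>k \<in> B\<close> iff \<open>ak = 0\<close>. Hence for a
  regular ideal \<open>K\<close> of \<open>B\<close> the set \<open>J\<^sub>K\<close> is the left annihilator of \<open>K\<^sup>\<bottom>\<close> in \<open>A\<close>. If \<open>K\<close> is invariant,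
  so is \<open>K\<^sup>\<bottom>\<close>, and density of the span of the normalizers makes \<open>J\<^sub>K\<close> a two-sided, regular ideal
  with \<open>J\<^sub>K \<inter> B = K\<close>. The intersection property then yields \<open>(J \<inter> B)\<^sup>\<bottom> = J\<^sup>\<bottom> \<inter> B\<close> for
  regular \<open>J\<close>, from which everything else is formal. C*-algebras enter the ideal theory only through
  semiprimeness: \<open>x x\<^sup>* x = 0\<close> implies \<open>x = 0\<close>.\<close>

section \<open>Annihilators of ideals\<close>

lemma star_zero [simp]: "star (0::'a::cstar_algebra) = 0"
  using star_add[of "0::'a" 0] by simp

lemma star_mult_self_eq_zero [simp]: "star x * x = 0 \<longleftrightarrow> x = (0::'a::cstar_algebra)"
  using norm_star_mult_self[of x] by auto

lemma mult_star_self_eq_zero [simp]: "x * star x = 0 \<longleftrightarrow> x = (0::'a::cstar_algebra)"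
  using star_mult_self_eq_zero[of "star x"] by (metis star_star star_zero)

text \<open>Multiplying by \<open>star x\<close> on the left makes \<open>star y * y\<close> vanish
  for \<open>y = star x * x\<close>; the C*-identity then applies twice.\<close>

lemma mult_star_mult_self_eq_zero:
  fixes x :: "'a::cstar_algebra"
  assumes "x * star x * x = 0"
  shows "x = 0"
proof -
  have "star (star x * x) * (star x * x) = star x * (x * star x * x)"
    by (simp add: star_mult star_star mult.assoc)
  then have "star x * x = 0"
    using assms by (metis mult_zero_right star_mult_self_eq_zero)
  then show ?thesis by simp
qed

lemma cstar_subalgebra_UNIV: "cstar_subalgebra UNIV"
  by (simp add: cstar_subalgebra_def complex_vector.subspace_UNIV)

lemma annihilator_in_UNIV: "annihilator_in UNIV X = annihilator X"
  by (simp add: annihilator_in_def)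

lemma ideal_in_mult_left: "ideal_in B J \<Longrightarrow> b \<in> B \<Longrightarrow> x \<in> J \<Longrightarrow> b * x \<in> J"
  by (simp add: ideal_in_def)

lemma ideal_in_mult_right: "ideal_in B J \<Longrightarrow> b \<in> B \<Longrightarrow> x \<in> J \<Longrightarrow> x * b \<in> J"
  by (simp add: ideal_in_def)

lemma ideal_in_subset: "ideal_in B J \<Longrightarrow> J \<subseteq> B"
  by (simp add: ideal_in_def)

lemma ideal_in_zero_mem: "ideal_in B J \<Longrightarrow> 0 \<in> J"
  by (simp add: ideal_in_def complex_vector.subspace_0)

lemma ideal_in_Int: "ideal_in B J \<Longrightarrow> ideal_in B K \<Longrightarrow> ideal_in B (J \<inter> K)"
  by (auto simp: ideal_in_def complex_vector.subspace_inter)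

lemma cstar_subalgebra_starD: "cstar_subalgebra B \<Longrightarrow> x \<in> B \<Longrightarrow> star x \<in> B"
  by (simp add: cstar_subalgebra_def)

lemma cstar_subalgebra_zero_mem: "cstar_subalgebra B \<Longrightarrow> 0 \<in> B"
  by (simp add: cstar_subalgebra_def complex_vector.subspace_0)

lemma csubspace_left_annihilator:
  "csubspace {a::'a::cstar_algebra. \<forall>x\<in>X. a * x = 0}"
  by (auto simp: complex_vector.subspace_def distrib_right mult_scaleC_left
        complex_vector.scale_zero_right)

lemma closed_left_annihilator:
  "closed {a::'a::cstar_algebra. \<forall>x\<in>X. a * x = 0}"
proof -
  have "closed (\<Inter>x\<in>X. {a. a * x = 0})"
    by (intro closed_INT ballI closed_Collect_eq continuous_intros)
  then show ?thesis
    by (simp add: INTER_eq)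
qed

text \<open>One side suffices: if \<open>a * J = 0\<close> and \<open>y = x * a\<close>, then
  \<open>y * star y * y = x * (a * (star y * x)) * a\<close>. Here \<open>star y * x\<close> lies in
  \<open>J\<close>, so the product vanishes and semiprimeness gives \<open>y = 0\<close>.\<close>

lemma annihilator_in_eq_left:
  assumes B: "cstar_subalgebra B" and J: "ideal_in B J"
  shows "annihilator_in B J = {a \<in> B. \<forall>x\<in>J. a * x = 0}"
proof -
  have "x * a = 0" if a: "a \<in> B" "\<forall>x\<in>J. a * x = 0" and x: "x \<in> J" for a x
  proof (rule mult_star_mult_self_eq_zero)
    have "x * a \<in> B"
      using ideal_in_mult_right[OF J a(1) x] ideal_in_subset[OF J] by blast
    then have "star (x * a) * x \<in> J"
      using J B x cstar_subalgebra_starD ideal_in_mult_left by blast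
    then have "x * (a * (star (x * a) * x)) * a = 0"
      using a(2) by simp
    then show "x * a * star (x * a) * (x * a) = 0"
      by (simp add: mult.assoc)
  qed
  then show ?thesis
    by (auto simp: annihilator_in_def annihilator_def)
qed

lemma annihilator_in_eq_right:
  assumes B: "cstar_subalgebra B" and J: "ideal_in B J"
  shows "annihilator_in B J = {a \<in> B. \<forall>x\<in>J. x * a = 0}"
proof -
  have "a * x = 0" if a: "a \<in> B" "\<forall>x\<in>J. x * a = 0" and x: "x \<in> J" for a x
  proof (rule mult_star_mult_self_eq_zero)
    have "a * x \<in> B"
      using ideal_in_mult_left[OF J a(1) x] ideal_in_subset[OF J] by blast
    then have "x * star (a * x) \<in> J"
      using J B x cstar_subalgebra_starD ideal_in_mult_right by blast
    then have "a * ((x * star (a * x)) * a) * x = 0"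
      using a(2) by simp
    then show "a * x * star (a * x) * (a * x) = 0"
      by (simp add: mult.assoc)
  qed
  then show ?thesis
    by (auto simp: annihilator_in_def annihilator_def)
qed

text \<open>In the one-sided description only right multiplication uses that \<open>J\<close> is an
  ideal: \<open>(a * b) * x = a * (b * x)\<close> with \<open>b * x\<close> again in
  \<open>J\<close>.\<close>

lemma ideal_in_annihilator_in:
  assumes B: "cstar_subalgebra B" and J: "ideal_in B J"
  shows "ideal_in B (annihilator_in B J)"
proof -
  have eq: "annihilator_in B J = {a. \<forall>x\<in>J. a * x = 0} \<inter> B"
    using annihilator_in_eq_left[OF B J] by blast
  have "csubspace (annihilator_in B J)" "closed (annihilator_in B J)"
    unfolding eq using B
    by (simp_all add: cstar_subalgebra_def complex_vector.subspace_inter closed_Int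
          csubspace_left_annihilator closed_left_annihilator)
  moreover have "b * a \<in> annihilator_in B J \<and> a * b \<in> annihilator_in B J"
    if "b \<in> B" "a \<in> annihilator_in B J" for a b
    using that B J unfolding eq
    by (auto simp: mult.assoc cstar_subalgebra_def ideal_in_mult_left)
  ultimately show ?thesis
    by (auto simp: ideal_in_def annihilator_in_def)
qed

lemma annihilator_in_antimono: "J \<subseteq> K \<Longrightarrow> annihilator_in B K \<subseteq> annihilator_in B J"
  by (auto simp: annihilator_in_def annihilator_def)

lemma subset_annihilator_in_twice:
  "J \<subseteq> B \<Longrightarrow> J \<subseteq> annihilator_in B (annihilator_in B J)"
  by (auto simp: annihilator_in_def annihilator_def)

text \<open>This makes the annihilator a pseudocomplement on ideals. Products of elements of
  \<open>J\<close> and \<open>K\<close> fall into both ideals; conversely, a common element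
  \<open>x\<close> annihilates \<open>star x * x\<close>, which lies in \<open>J\<close>.\<close>

lemma Int_eq_zero_iff_subset_annihilator_in:
  assumes B: "cstar_subalgebra B" and J: "ideal_in B J" and K: "ideal_in B K"
  shows "J \<inter> K = {0} \<longleftrightarrow> K \<subseteq> annihilator_in B J"
proof
  assume 0: "J \<inter> K = {0}"
  have "k * x = 0 \<and> x * k = 0" if "k \<in> K" "x \<in> J" for k x
  proof -
    have "k \<in> B" "x \<in> B"
      using that J K ideal_in_subset by blast+
    then have "k * x \<in> J \<inter> K" "x * k \<in> J \<inter> K"
      using that J K by (auto simp: ideal_in_mult_left ideal_in_mult_right)
    then show ?thesis using 0 by blast
  qed
  then show "K \<subseteq> annihilator_in B J"
    using ideal_in_subset[OF K] by (auto simp: annihilator_in_def annihilator_def)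
next
  assume sub: "K \<subseteq> annihilator_in B J"
  have "x = 0" if x: "x \<in> J" "x \<in> K" for x
  proof (rule mult_star_mult_self_eq_zero)
    have "star x * x \<in> J"
      using B J x(1) ideal_in_subset[OF J] cstar_subalgebra_starD ideal_in_mult_left by blast
    then show "x * star x * x = 0"
      using sub x(2) by (auto simp: annihilator_in_def annihilator_def mult.assoc)
  qed
  then show "J \<inter> K = {0}"
    using J K ideal_in_zero_mem by auto
qed

section \<open>Regular ideals\<close>

lemma regular_ideal_inD:
  assumes "regular_ideal_in B J"
  shows "ideal_in B J" "annihilator_in B (annihilator_in B J) = J"
  using assms by (simp_all add: regular_ideal_in_def)

text \<open>The annihilator is an antitone Galois connection with itself, so three applications
  collapse to one.\<close>

lemma regular_ideal_in_annihilator_in: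
  assumes B: "cstar_subalgebra B" and J: "ideal_in B J"
  shows "regular_ideal_in B (annihilator_in B J)"
proof -
  have "annihilator_in B (annihilator_in B (annihilator_in B J)) \<subseteq> annihilator_in B J"
    by (intro annihilator_in_antimono subset_annihilator_in_twice ideal_in_subset J)
  moreover have "annihilator_in B J
      \<subseteq> annihilator_in B (annihilator_in B (annihilator_in B J))"
    by (rule subset_annihilator_in_twice) (simp add: annihilator_in_def)
  ultimately show ?thesis
    using ideal_in_annihilator_in[OF B J] by (simp add: regular_ideal_in_def)
qed

lemma regular_ideal_in_Int:
  assumes B: "cstar_subalgebra B" and J: "regular_ideal_in B J" and K: "regular_ideal_in B K"
  shows "regular_ideal_in B (J \<inter> K)"
proof -
  have id: "ideal_in B (J \<inter> K)"
    using J K by (simp add: regular_ideal_inD ideal_in_Int)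
  have "annihilator_in B (annihilator_in B (J \<inter> K))
      \<subseteq> annihilator_in B (annihilator_in B J) \<inter> annihilator_in B (annihilator_in B K)"
    by (simp add: annihilator_in_antimono)
  then have "annihilator_in B (annihilator_in B (J \<inter> K)) \<subseteq> J \<inter> K"
    using J K by (simp add: regular_ideal_inD)
  then show ?thesis
    using id subset_annihilator_in_twice[OF ideal_in_subset[OF id]]
    unfolding regular_ideal_in_def by blast
qed

lemma ideal_in_self: "cstar_subalgebra B \<Longrightarrow> ideal_in B B"
  by (simp add: ideal_in_def cstar_subalgebra_def)

lemma ideal_in_zero: "cstar_subalgebra B \<Longrightarrow> ideal_in B {0}"
  by (simp add: ideal_in_def cstar_subalgebra_zero_mem complex_vector.subspace_single_0)

lemma annihilator_in_zero: "annihilator_in B {0} = B"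
  by (auto simp: annihilator_in_def annihilator_def)

lemma annihilator_in_self:
  assumes "cstar_subalgebra B"
  shows "annihilator_in B B = {0}"
  using assms cstar_subalgebra_starD[OF assms] cstar_subalgebra_zero_mem[OF assms]
  by (auto simp: annihilator_in_def annihilator_def) (metis mult_star_self_eq_zero)

lemma regular_ideal_in_zero: "cstar_subalgebra B \<Longrightarrow> regular_ideal_in B {0}"
  by (simp add: regular_ideal_in_def ideal_in_zero annihilator_in_zero annihilator_in_self)

lemma regular_ideal_in_self: "cstar_subalgebra B \<Longrightarrow> regular_ideal_in B B"
  by (simp add: regular_ideal_in_def ideal_in_self annihilator_in_zero annihilator_in_self)

text \<open>Puts the join in de Morgan form without an explicit description of the generated ideal:
  \<open>J\<close> and \<open>K\<close> lie in the annihilator of the right-hand side, which is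
  itself an ideal and so contains the generated one.\<close>

lemma annihilator_in_ideal_generated_Un:
  assumes B: "cstar_subalgebra B" and J: "ideal_in B J" and K: "ideal_in B K"
  shows "annihilator_in B (ideal_generated_in B (J \<union> K))
    = annihilator_in B J \<inter> annihilator_in B K" (is "?L = ?R")
proof
  have "J \<union> K \<subseteq> ideal_generated_in B (J \<union> K)"
    by (auto simp: ideal_generated_in_def)
  then have "?L \<subseteq> annihilator_in B (J \<union> K)"
    by (rule annihilator_in_antimono)
  then show "?L \<subseteq> ?R"
    by (auto simp: annihilator_in_def annihilator_def)
next
  have id: "ideal_in B (annihilator_in B ?R)"
    by (intro ideal_in_annihilator_in ideal_in_Int B J K)
  have "J \<subseteq> annihilator_in B ?R" "K \<subseteq> annihilator_in B ?R"
    using ideal_in_subset[OF J] ideal_in_subset[OF K]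
    by (auto simp: annihilator_in_def annihilator_def)
  then have "ideal_generated_in B (J \<union> K) \<subseteq> annihilator_in B ?R"
    using id by (auto simp: ideal_generated_in_def)
  then have "annihilator_in B (annihilator_in B ?R) \<subseteq> ?L"
    by (rule annihilator_in_antimono)
  moreover have "?R \<subseteq> annihilator_in B (annihilator_in B ?R)"
    by (rule subset_annihilator_in_twice) (auto simp: annihilator_in_def)
  ultimately show "?R \<subseteq> ?L" by blast
qed

section \<open>Boolean algebras from pseudocomplements\<close>

text \<open>Glivenko's theorem: an intersection-closed family of sets whose pseudocomplement is an
  involution is a Boolean algebra.\<close>

lemma is_boolean_algebra_pseudocomplement:
  fixes L :: "'b set boolalg"
  assumes meet: "\<And>x y. meet L x y = x \<inter> y"
    and join: "\<And>x y. x \<in> carrier L \<Longrightarrow> y \<in> carrier L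
      \<Longrightarrow> join L x y = compl L (compl L x \<inter> compl L y)"
    and bot: "bottom L \<in> carrier L" "\<And>x. x \<in> carrier L \<Longrightarrow> bottom L \<subseteq> x"
    and top: "top_el L \<in> carrier L" "\<And>x. x \<in> carrier L \<Longrightarrow> x \<subseteq> top_el L"
    and Int: "\<And>x y. x \<in> carrier L \<Longrightarrow> y \<in> carrier L \<Longrightarrow> x \<inter> y \<in> carrier L"
    and compl: "\<And>x. x \<in> carrier L \<Longrightarrow> compl L x \<in> carrier L"
    and invol: "\<And>x. x \<in> carrier L \<Longrightarrow> compl L (compl L x) = x"
    and pseudo: "\<And>x y. x \<in> carrier L \<Longrightarrow> y \<in> carrier L
      \<Longrightarrow> x \<inter> y = bottom L \<longleftrightarrow> y \<subseteq> compl L x"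
  shows "is_boolean_algebra L"
proof -
  let ?C = "carrier L" and ?c = "compl L"
  have joinC: "join L x y \<in> ?C" if "x \<in> ?C" "y \<in> ?C" for x y
    using that by (simp add: join compl Int)
  have anti: "?c y \<subseteq> ?c x" if "x \<subseteq> y" "x \<in> ?C" "y \<in> ?C" for x y
  proof -
    have "y \<inter> ?c y = bottom L"
      using that by (simp add: pseudo compl)
    then have "x \<inter> ?c y = bottom L"
      using that bot(2)[of x] bot(2)[of "?c y"] compl[of y] by blast
    then show ?thesis using that by (simp add: pseudo compl)
  qed
  have ub: "x \<subseteq> join L x y" "y \<subseteq> join L x y" if "x \<in> ?C" "y \<in> ?C" for x y
    using that anti[of "?c x \<inter> ?c y" "?c x"] anti[of "?c x \<inter> ?c y" "?c y"]
    by (simp_all add: join invol compl Int)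
  have lub: "join L x y \<subseteq> z" if "x \<in> ?C" "y \<in> ?C" "z \<in> ?C" "x \<subseteq> z" "y \<subseteq> z" for x y z
  proof -
    have "?c z \<subseteq> ?c x \<inter> ?c y"
      using that anti by simp
    then have "?c (?c x \<inter> ?c y) \<subseteq> ?c (?c z)"
      using that by (intro anti compl Int) auto
    then show ?thesis using that by (simp add: join invol)
  qed
  have distrib: "x \<inter> join L y z = join L (x \<inter> y) (x \<inter> z)"
    if C: "x \<in> ?C" "y \<in> ?C" "z \<in> ?C" for x y z
  proof
    \<comment> \<open>The nontrivial inclusion: the left-hand side is shown to miss
      \<open>?c m\<close>, hence to lie below \<open>?c (?c m) = m\<close>.\<close>
    define m where "m = join L (x \<inter> y) (x \<inter> z)"
    have mC: "m \<in> ?C" using C by (simp add: m_def joinC Int)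
    have le: "x \<inter> y \<subseteq> m" "x \<inter> z \<subseteq> m"
      unfolding m_def by (intro ub Int C)+
    have mm: "m \<inter> ?c m = bottom L"
      using mC by (simp add: pseudo compl)
    \<comment> \<open>Used for \<open>w = y\<close> and \<open>w = z\<close>: the meet of
      \<open>x\<close> and \<open>?c m\<close> then lies below both \<open>?c y\<close> and
      \<open>?c z\<close>, hence misses the join of \<open>y\<close> and \<open>z\<close>.\<close>
    have "w \<inter> (x \<inter> ?c m) = bottom L" if "w \<in> ?C" "x \<inter> w \<subseteq> m" for w
    proof
      show "w \<inter> (x \<inter> ?c m) \<subseteq> bottom L" using that(2) mm by blast
      show "bottom L \<subseteq> w \<inter> (x \<inter> ?c m)"
        by (intro bot(2) Int compl that(1) C(1) mC)
    qed
    then have "x \<inter> ?c m \<subseteq> ?c y" "x \<inter> ?c m \<subseteq> ?c z"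
      using C le mC by (simp_all add: pseudo Int compl)
    then have sub: "x \<inter> ?c m \<subseteq> ?c y \<inter> ?c z" by blast
    have "(?c y \<inter> ?c z) \<inter> join L y z = bottom L"
      using C by (simp add: join pseudo compl Int)
    then have "?c m \<inter> (x \<inter> join L y z) \<subseteq> bottom L" using sub by blast
    then have "?c m \<inter> (x \<inter> join L y z) = bottom L"
      using C mC by (meson Int bot(2) compl joinC subset_antisym)
    then have "x \<inter> join L y z \<subseteq> ?c (?c m)"
      using C mC by (simp add: pseudo Int compl joinC)
    then show "x \<inter> join L y z \<subseteq> join L (x \<inter> y) (x \<inter> z)"
      using mC by (simp add: invol m_def)
  next
    show "join L (x \<inter> y) (x \<inter> z) \<subseteq> x \<inter> join L y z"
      using C ub[OF C(2,3)] by (intro lub Int joinC) auto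
  qed
  \<comment> \<open>The de Morgan dual: \<open>distrib\<close> for the three complements,
    complemented once more.\<close>
  have codistrib: "join L x (y \<inter> z) = join L x y \<inter> join L x z"
    if C: "x \<in> ?C" "y \<in> ?C" "z \<in> ?C" for x y z
  proof -
    have "join L (?c y) (?c z) = ?c (y \<inter> z)"
      using C by (simp add: join compl invol)
    then have "?c x \<inter> ?c (y \<inter> z) = join L (?c x \<inter> ?c y) (?c x \<inter> ?c z)"
      using distrib[of "?c x" "?c y" "?c z"] C by (simp add: compl)
    then have "?c (?c x \<inter> ?c (y \<inter> z)) = join L x y \<inter> join L x z"
      using C by (simp add: join compl Int invol)
    then show ?thesis using C by (simp add: join Int)
  qed
  have compl_cap: "x \<inter> ?c x = bottom L" if "x \<in> ?C" for x
    using that by (simp add: pseudo compl)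
  have "?c (bottom L) = top_el L"
    using pseudo[of "bottom L" "top_el L"] bot top compl by (simp add: Int_absorb2 subset_antisym)
  then have compl_cup: "join L x (?c x) = top_el L" if "x \<in> ?C" for x
    using that by (simp add: join compl invol Int_commute compl_cap)
  have bot_unit: "join L x (bottom L) = x" if "x \<in> ?C" for x
    using that ub[of x "bottom L"] lub[of x "bottom L" x] bot by blast
  have top_unit: "x \<inter> top_el L = x" if "x \<in> ?C" for x
    using that top(2) by blast
  have absorb: "x \<inter> join L x y = x" "join L x (x \<inter> y) = x" if "x \<in> ?C" "y \<in> ?C" for x y
    using that ub[of x y] ub[of x "x \<inter> y"] lub[of x "x \<inter> y" x] Int[of x y] by blast+
  have comm: "join L x y = join L y x" if "x \<in> ?C" "y \<in> ?C" for x y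
    using that by (simp add: join Int_commute)
  have assoc: "join L (join L x y) z = join L x (join L y z)"
    if "x \<in> ?C" "y \<in> ?C" "z \<in> ?C" for x y z
    using that by (simp add: join compl Int invol Int_assoc)
  show ?thesis
    unfolding is_boolean_algebra_def meet
    by (intro conjI ballI; rule bot(1) top(1) Int compl joinC compl_cap compl_cup top_unit bot_unit
        absorb comm assoc distrib codistrib Int_commute Int_assoc; assumption)
qed

lemma regular_ideal_algebra_join:
  assumes B: "cstar_subalgebra B" and J: "regular_ideal_in B J" and K: "regular_ideal_in B K"
  shows "join (regular_ideal_algebra B) J K
    = annihilator_in B (annihilator_in B J \<inter> annihilator_in B K)"
  using J K by (simp add: regular_ideal_algebra_def
      annihilator_in_ideal_generated_Un[OF B] regular_ideal_inD)

lemma is_boolean_algebra_regular_ideals: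
  assumes B: "cstar_subalgebra B"
  shows "is_boolean_algebra (regular_ideal_algebra B)"
proof (rule is_boolean_algebra_pseudocomplement)
  show "join (regular_ideal_algebra B) J K = compl (regular_ideal_algebra B)
      (compl (regular_ideal_algebra B) J \<inter> compl (regular_ideal_algebra B) K)"
    if "J \<in> carrier (regular_ideal_algebra B)" "K \<in> carrier (regular_ideal_algebra B)" for J K
    using that regular_ideal_algebra_join[OF B] by (simp add: regular_ideal_algebra_def)
  show "bottom (regular_ideal_algebra B) \<subseteq> J"
    "J \<subseteq> top_el (regular_ideal_algebra B)"
    if "J \<in> carrier (regular_ideal_algebra B)" for J
    using that ideal_in_zero_mem[of B J] ideal_in_subset[of B J]
    by (simp_all add: regular_ideal_algebra_def regular_ideal_inD)
qed (use B in \<open>simp_all add: regular_ideal_algebra_def regular_ideal_inD regular_ideal_in_zero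
      regular_ideal_in_self regular_ideal_in_Int regular_ideal_in_annihilator_in
      Int_eq_zero_iff_subset_annihilator_in\<close>)

section \<open>Invariant ideals\<close>

lemma star_mem_normalizers: "n \<in> normalizers B \<Longrightarrow> star n \<in> normalizers B"
  by (simp add: normalizers_def star_star)

lemma invariant_ideal_zero: "cstar_subalgebra B \<Longrightarrow> invariant_ideal B {0}"
  by (simp add: invariant_ideal_def ideal_in_zero)

lemma invariant_ideal_self: "cstar_subalgebra B \<Longrightarrow> invariant_ideal B B"
  by (simp add: invariant_ideal_def ideal_in_self normalizers_def)

lemma invariant_ideal_Int:
  "invariant_ideal B J \<Longrightarrow> invariant_ideal B K \<Longrightarrow> invariant_ideal B (J \<inter> K)"
  by (simp add: invariant_ideal_def ideal_in_Int)

text \<open>For \<open>y = n * l * star n * k\<close>, the product \<open>y * star y\<close>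
  contains the factor \<open>l * (star n * (k * star k) * n)\<close>. Invariance of \<open>K\<close>
  under the normalizer \<open>star n\<close> puts the bracket into \<open>K\<close>, where
  \<open>l\<close> kills it.\<close>

lemma invariant_ideal_annihilator_in:
  assumes B: "cstar_subalgebra B" and K: "invariant_ideal B K"
  shows "invariant_ideal B (annihilator_in B K)"
proof -
  have Ki: "ideal_in B K"
    and Kn: "\<And>n k. n \<in> normalizers B \<Longrightarrow> k \<in> K \<Longrightarrow> n * k * star n \<in> K"
    using K by (auto simp: invariant_ideal_def)
  have "n * l * star n \<in> annihilator_in B K"
    if n: "n \<in> normalizers B" and l: "l \<in> annihilator_in B K" for n l
  proof -
    have "n * l * star n \<in> B"
      using n l by (auto simp: normalizers_def annihilator_in_def)
    moreover have "n * l * star n * k = 0" if k: "k \<in> K" for k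
    proof -
      have "k * star k \<in> K"
        using k B Ki ideal_in_subset cstar_subalgebra_starD ideal_in_mult_right by blast
      then have "star n * (k * star k) * n \<in> K"
        using Kn[OF star_mem_normalizers[OF n]] by (simp add: star_star)
      then have "l * (star n * (k * star k) * n) = 0"
        using l by (simp add: annihilator_in_def annihilator_def)
      then have "n * (l * (star n * (k * star k) * n)) * (star l * star n) = 0"
        by simp
      then have "(n * l * star n * k) * star (n * l * star n * k) = 0"
        by (simp add: star_mult star_star mult.assoc)
      then show ?thesis
        using mult_star_self_eq_zero by blast
    qed
    ultimately show ?thesis
      using annihilator_in_eq_left[OF B Ki] by blast
  qed
  then show ?thesis
    using ideal_in_annihilator_in[OF B Ki] by (simp add: invariant_ideal_def)
qed

lemma invariant_ideal_restrict:
  assumes B: "cstar_subalgebra B" and J: "ideal_in UNIV J"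
  shows "invariant_ideal B (J \<inter> B)"
  using assms
  by (auto simp: invariant_ideal_def ideal_in_def cstar_subalgebra_def normalizers_def
        complex_vector.subspace_inter)

text \<open>Invariance survives intersections and annihilators. The join is the de Morgan expression
  in these, so the pseudocomplement criterion applies to the smaller carrier as well.\<close>

lemma is_boolean_algebra_invariant_regular_ideals:
  assumes B: "cstar_subalgebra B"
  shows "is_boolean_algebra (invariant_regular_ideal_algebra B)"
proof (rule is_boolean_algebra_pseudocomplement)
  show "join (invariant_regular_ideal_algebra B) J K = compl (invariant_regular_ideal_algebra B)
      (compl (invariant_regular_ideal_algebra B) J
        \<inter> compl (invariant_regular_ideal_algebra B) K)"
    if "J \<in> carrier (invariant_regular_ideal_algebra B)"
      "K \<in> carrier (invariant_regular_ideal_algebra B)" for J K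
    using that regular_ideal_algebra_join[OF B]
    by (simp add: invariant_regular_ideal_algebra_def regular_ideal_algebra_def)
  show "bottom (invariant_regular_ideal_algebra B) \<subseteq> J"
    "J \<subseteq> top_el (invariant_regular_ideal_algebra B)"
    if "J \<in> carrier (invariant_regular_ideal_algebra B)" for J
    using that ideal_in_zero_mem[of B J] ideal_in_subset[of B J]
    by (simp_all add: invariant_regular_ideal_algebra_def regular_ideal_algebra_def regular_ideal_inD)
qed (use B in \<open>simp_all add: invariant_regular_ideal_algebra_def regular_ideal_algebra_def
      regular_ideal_inD regular_ideal_in_zero
      regular_ideal_in_self regular_ideal_in_Int regular_ideal_in_annihilator_in
      Int_eq_zero_iff_subset_annihilator_in invariant_ideal_zero invariant_ideal_self
      invariant_ideal_Int invariant_ideal_annihilator_in\<close>)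

text \<open>Only stability under right multiplication by \<open>b\<close> needs work. For fixed
  \<open>a\<close> and \<open>x\<close>, the \<open>b\<close> with \<open>a * b * x = 0\<close> form
  a closed subspace. It contains each normalizer \<open>n\<close>, because
  \<open>(a * n * x) * star (a * n * x)\<close> has the factor
  \<open>a * (n * (x * star x) * star n)\<close>, which is zero by invariance of \<open>L\<close>;
  density does the rest.\<close>

lemma ideal_in_left_annihilator_invariant:
  assumes B: "cstar_subalgebra B" and dense: "closure (cspan (normalizers B)) = UNIV"
    and L: "invariant_ideal B L"
  shows "ideal_in UNIV {a. \<forall>x\<in>L. a * x = 0}"
proof -
  have Li: "ideal_in B L"
    and Ln: "\<And>n k. n \<in> normalizers B \<Longrightarrow> k \<in> L \<Longrightarrow> n * k * star n \<in> L"
    using L by (auto simp: invariant_ideal_def)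
  have "a * b * x = 0" if a: "\<forall>x\<in>L. a * x = 0" and x: "x \<in> L" for a b x
  proof -
    let ?S = "{b. a * b * x = 0}"
    have "closed ?S"
      by (intro closed_Collect_eq continuous_intros)
    moreover have "csubspace ?S"
      by (auto simp: complex_vector.subspace_def distrib_left distrib_right mult_scaleC_left
            mult_scaleC_right complex_vector.scale_zero_right)
    moreover have "normalizers B \<subseteq> ?S"
    proof
      fix n assume n: "n \<in> normalizers B"
      have "x * star x \<in> L"
        using x B Li ideal_in_subset cstar_subalgebra_starD ideal_in_mult_right by blast
      then have "a * (n * (x * star x) * star n) = 0"
        using a Ln[OF n] by blast
      then have "a * (n * (x * star x) * star n) * star a = 0"
        by simp
      then have "(a * n * x) * star (a * n * x) = 0"
        by (simp add: star_mult mult.assoc)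
      then show "n \<in> ?S"
        using mult_star_self_eq_zero by blast
    qed
    ultimately have "closure (cspan (normalizers B)) \<subseteq> ?S"
      by (intro closure_minimal complex_vector.span_minimal)
    then show ?thesis using dense by blast
  qed
  then show ?thesis
    by (auto simp: ideal_in_def csubspace_left_annihilator closed_left_annihilator mult.assoc)
qed

section \<open>The ideal of an expectation\<close>

lemma expectation_ideal_eq_left_annihilator:
  assumes B: "cstar_subalgebra B" and E: "conditional_expectation B E"
    and faithful: "faithful_expectation E" and K: "regular_ideal_in B K"
  shows "expectation_ideal E K = {a. \<forall>x\<in>annihilator_in B K. a * x = 0}"
proof -
  let ?L = "annihilator_in B K"
  have Ki: "ideal_in B K" and L: "ideal_in B ?L"
    using K by (simp_all add: regular_ideal_inD ideal_in_annihilator_in[OF B])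
  \<comment> \<open>Regularity turns membership in \<open>K\<close> into equations against
    \<open>?L\<close>, which can be tested on \<open>E (star a * a)\<close>.\<close>
  have K_eq: "K = {b \<in> B. \<forall>x\<in>?L. b * x = 0}"
    using annihilator_in_eq_left[OF B L] K by (simp add: regular_ideal_inD)
  have EB: "E a \<in> B" and EL: "x \<in> B \<Longrightarrow> E (x * a) = x * E a"
    and ER: "x \<in> B \<Longrightarrow> E (a * x) = E a * x" for a x
    using E by (auto simp: conditional_expectation_def)
  have E0: "E 0 = 0"
    using E unfolding conditional_expectation_def by (metis add_cancel_right_left)
  \<comment> \<open>The bimodule property gives
    \<open>star x * E (star a * a) * x = E (star (a * x) * (a * x))\<close>, and faithfulness
    detects \<open>a * x\<close> on the right.\<close>
  have iff: "E (star a * a) * x = 0 \<longleftrightarrow> a * x = 0" if "x \<in> ?L" for a x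
  proof -
    have x: "x \<in> B" "star x \<in> B"
      using that B cstar_subalgebra_starD by (auto simp: annihilator_in_def)
    show ?thesis
    proof
      assume "E (star a * a) * x = 0"
      then have "E (star x * (star a * a * x)) = 0"
        by (simp add: EL ER x)
      then have "E (star (a * x) * (a * x)) = 0"
        by (simp add: star_mult mult.assoc)
      then show "a * x = 0"
        using faithful unfolding faithful_expectation_def by blast
    next
      assume "a * x = 0"
      then have "E (star a * a * x) = 0"
        by (simp add: mult.assoc E0)
      then show "E (star a * a) * x = 0"
        by (simp add: ER x)
    qed
  qed
  have "E (star a * a) \<in> K \<longleftrightarrow> (\<forall>x\<in>?L. a * x = 0)" for a
    by (subst K_eq) (simp add: EB iff)
  then show ?thesis by (simp add: expectation_ideal_def)
qed

text \<open>As the left annihilator of \<open>?L\<close>, the ideal contains its double annihilator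
  as soon as \<open>?L\<close> annihilates it; its trace on \<open>B\<close> is the annihilator of
  \<open>?L\<close> in \<open>B\<close>, which is \<open>K\<close> by regularity.\<close>

lemma regular_ideal_in_expectation_ideal:
  assumes B: "cstar_subalgebra B" and dense: "closure (cspan (normalizers B)) = UNIV"
    and E: "conditional_expectation B E" and faithful: "faithful_expectation E"
    and K: "regular_ideal_in B K" "invariant_ideal B K"
  shows "regular_ideal_in UNIV (expectation_ideal E K)" "expectation_ideal E K \<inter> B = K"
proof -
  let ?L = "annihilator_in B K" and ?I = "expectation_ideal E K"
  have I: "?I = {a. \<forall>x\<in>?L. a * x = 0}"
    by (rule expectation_ideal_eq_left_annihilator[OF B E faithful K(1)])
  have id: "ideal_in UNIV ?I"
    unfolding I
    by (intro ideal_in_left_annihilator_invariant[OF B dense] invariant_ideal_annihilator_in B K)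
  have L: "ideal_in B ?L"
    using K by (simp add: regular_ideal_inD ideal_in_annihilator_in[OF B])
  \<comment> \<open>Since \<open>?I\<close> is a two-sided ideal, the one-sided relation
    \<open>?I * ?L = 0\<close> that defines it is enough.\<close>
  have "?L \<subseteq> annihilator_in UNIV ?I"
    unfolding annihilator_in_eq_right[OF cstar_subalgebra_UNIV id] by (auto simp: I)
  then have "annihilator_in UNIV (annihilator_in UNIV ?I) \<subseteq> ?I"
    by (subst (2) I) (auto simp: annihilator_in_def annihilator_def)
  then show "regular_ideal_in UNIV ?I"
    using id subset_annihilator_in_twice[of ?I UNIV] by (simp add: regular_ideal_in_def)
  have "?I \<inter> B = annihilator_in B ?L"
    unfolding annihilator_in_eq_left[OF B L] I by blast
  then show "?I \<inter> B = K"
    using K by (simp add: regular_ideal_inD)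
qed

section \<open>The isomorphism\<close>

theorem theorem3p24:
  fixes B N :: "'a::cstar_algebra set" and E :: "'a \<Rightarrow> 'a"
  assumes "regular_inclusion B"
    and "regular_ideal_intersection_property B"
    and "N \<subseteq> normalizers B"
    and "star_semigroup N"
    and "closure (cspan N) = UNIV"
    and "conditional_expectation B E"
    and "faithful_expectation E"
    and "invariant_expectation N E"
  shows "is_boolean_algebra (invariant_regular_ideal_algebra B)
    \<and> boolean_algebra_isomorphism (regular_ideal_algebra UNIV)
        (invariant_regular_ideal_algebra B) (\<lambda>J. J \<inter> B)
    \<and> (\<forall>J \<in> carrier (regular_ideal_algebra UNIV). expectation_ideal E (J \<inter> B) = J)
    \<and> (\<forall>K \<in> carrier (invariant_regular_ideal_algebra B).
          expectation_ideal E K \<in> carrier (regular_ideal_algebra UNIV)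
          \<and> expectation_ideal E K \<inter> B = K)"
proof -
  let ?R = "regular_ideal_algebra (UNIV::'a set)" and ?M = "invariant_regular_ideal_algebra B"
  note U = cstar_subalgebra_UNIV
  have B: "cstar_subalgebra B" and dense: "closure (cspan (normalizers B)) = UNIV"
    using assms(1) by (auto simp: regular_inclusion_def cstar_inclusion_def)
  note exp = regular_ideal_in_expectation_ideal[OF B dense assms(6,7)]
  \<comment> \<open>The intersection property enters here: the regular ideal
    \<open>J \<inter> K\<close> has zero trace on \<open>B\<close>, so it is zero.\<close>
  have disjoint: "K \<subseteq> annihilator J"
    if "regular_ideal_in UNIV J" "regular_ideal_in UNIV K" "J \<inter> K \<inter> B = {0}" for J K
  proof -
    have "J \<inter> K = {0}"
      using assms(2) regular_ideal_in_Int[OF U that(1,2)] that(3)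
      unfolding regular_ideal_intersection_property_def by blast
    then show ?thesis
      using that Int_eq_zero_iff_subset_annihilator_in[OF U, of J K]
      by (simp add: regular_ideal_inD annihilator_in_UNIV)
  qed
  have inv: "invariant_ideal B (J \<inter> B)" and res: "ideal_in B (J \<inter> B)"
    if "regular_ideal_in UNIV J" for J
    using that invariant_ideal_restrict[OF B] regular_ideal_inD(1)
    by (auto simp: invariant_ideal_def)
  \<comment> \<open>The decisive step. The annihilator \<open>?L\<close> of the trace is invariant
    and regular, so it extends to a regular ideal of the whole algebra with trace \<open>?L\<close>.
    That ideal meets \<open>J\<close> trivially inside \<open>B\<close>, hence lies in
    \<open>annihilator J\<close>; taking traces gives the nontrivial inclusion.\<close>
  have compl: "annihilator_in B (J \<inter> B) = annihilator J \<inter> B"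
    if J: "regular_ideal_in UNIV J" for J
  proof
    let ?L = "annihilator_in B (J \<inter> B)"
    have L: "regular_ideal_in B ?L" "invariant_ideal B ?L"
      by (intro regular_ideal_in_annihilator_in invariant_ideal_annihilator_in B inv res J)+
    have "(J \<inter> B) \<inter> ?L = {0}"
      using Int_eq_zero_iff_subset_annihilator_in[OF B res[OF J] regular_ideal_inD(1)[OF L(1)]]
      by simp
    then have "J \<inter> expectation_ideal E ?L \<inter> B = {0}"
      using exp(2)[OF L] by blast
    then have "expectation_ideal E ?L \<subseteq> annihilator J"
      using disjoint[OF J exp(1)[OF L]] by blast
    then show "?L \<subseteq> annihilator J \<inter> B"
      using exp(2)[OF L] by blast
    show "annihilator J \<inter> B \<subseteq> ?L"
      by (auto simp: annihilator_in_def annihilator_def)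
  qed
  have ann: "regular_ideal_in UNIV (annihilator J)" "annihilator (annihilator J) = J"
    if "regular_ideal_in UNIV J" for J
    using regular_ideal_in_annihilator_in[OF U regular_ideal_inD(1)[OF that]]
      regular_ideal_inD(2)[OF that] by (simp_all add: annihilator_in_UNIV)
  \<comment> \<open>Two uses of \<open>compl\<close>, for \<open>J\<close> and for
    \<open>annihilator J\<close>, carry double annihilators down to \<open>B\<close>.\<close>
  have reg: "regular_ideal_in B (J \<inter> B)" if J: "regular_ideal_in UNIV J" for J
    using compl[OF J] compl[OF ann(1)[OF J]] ann(2)[OF J] res[OF J]
    by (simp add: regular_ideal_in_def)
  \<comment> \<open>Traces reflect inclusion: if the trace of \<open>K\<close> lies in
    \<open>J\<close>, then \<open>annihilator J\<close> and \<open>K\<close> have no common nonzero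
    element in \<open>B\<close>, so \<open>K\<close> lies in the double annihilator of
    \<open>J\<close>.\<close>
  have subset: "K \<subseteq> J"
    if J: "regular_ideal_in UNIV J" and K: "regular_ideal_in UNIV K" and le: "K \<inter> B \<subseteq> J" for J K
  proof -
    have "J \<inter> annihilator J = {0}"
      using Int_eq_zero_iff_subset_annihilator_in[OF U, of J "annihilator J"] J ann(1)[OF J]
      by (simp add: regular_ideal_inD annihilator_in_UNIV)
    then have "annihilator J \<inter> K \<inter> B \<subseteq> {0}"
      using le by auto
    moreover have "0 \<in> annihilator J" "0 \<in> K" "0 \<in> B"
      using regular_ideal_inD(1)[OF ann(1)[OF J]] regular_ideal_inD(1)[OF K]
        cstar_subalgebra_zero_mem[OF B] by (simp_all add: ideal_in_zero_mem[of UNIV])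
    ultimately have "annihilator J \<inter> K \<inter> B = {0}"
      by auto
    from disjoint[OF ann(1)[OF J] K this] show ?thesis
      using ann(2)[OF J] by simp
  qed
  \<comment> \<open>Both sides are regular ideals with the same trace on \<open>B\<close>, so
    \<open>subset\<close> applies in both directions.\<close>
  have recover: "expectation_ideal E (J \<inter> B) = J" if J: "regular_ideal_in UNIV J" for J
    using subset[OF J exp(1)[OF reg[OF J] inv[OF J]]] subset[OF exp(1)[OF reg[OF J] inv[OF J]] J]
      exp(2)[OF reg[OF J] inv[OF J]] by auto
  have carR: "J \<in> carrier ?R \<longleftrightarrow> regular_ideal_in UNIV J" for J
    by (simp add: regular_ideal_algebra_def)
  have carM: "K \<in> carrier ?M \<longleftrightarrow> regular_ideal_in B K \<and> invariant_ideal B K" for K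
    by (simp add: invariant_regular_ideal_algebra_def)
  have bij: "bij_betw (\<lambda>J. J \<inter> B) (carrier ?R) (carrier ?M)"
    by (rule bij_betw_byWitness[where f' = "expectation_ideal E"])
      (auto simp: carR carM recover exp reg inv)
  have joins: "join ?R J K \<inter> B = join ?M (J \<inter> B) (K \<inter> B)"
    if J: "regular_ideal_in UNIV J" and K: "regular_ideal_in UNIV K" for J K
  proof -
    \<comment> \<open>In de Morgan form the outer annihilator is that of a regular ideal, so
      \<open>compl\<close> moves the trace inside it, and then inside the two inner ones.\<close>
    have "regular_ideal_in UNIV (annihilator J \<inter> annihilator K)"
      by (intro regular_ideal_in_Int U ann J K)
    then have "join ?R J K \<inter> B = annihilator_in B (annihilator J \<inter> annihilator K \<inter> B)"
      using J K by (simp add: regular_ideal_algebra_join[OF U] annihilator_in_UNIV compl)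
    also have "annihilator J \<inter> annihilator K \<inter> B
        = annihilator_in B (J \<inter> B) \<inter> annihilator_in B (K \<inter> B)"
      using J K by (auto simp: compl)
    also have "annihilator_in B \<dots> = join (regular_ideal_algebra B) (J \<inter> B) (K \<inter> B)"
      using J K by (simp add: regular_ideal_algebra_join[OF B] reg)
    finally show ?thesis
      by (simp add: invariant_regular_ideal_algebra_def regular_ideal_algebra_def)
  qed
  have "boolean_algebra_isomorphism ?R ?M (\<lambda>J. J \<inter> B)"
    unfolding boolean_algebra_isomorphism_def
  proof (intro conjI ballI)
    show "join ?R J K \<inter> B = join ?M (J \<inter> B) (K \<inter> B)"
      if "J \<in> carrier ?R" "K \<in> carrier ?R" for J K
      using that joins by (simp add: carR)
    show "compl ?R J \<inter> B = compl ?M (J \<inter> B)" if "J \<in> carrier ?R" for J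
      using that compl[of J]
      by (simp add: carR invariant_regular_ideal_algebra_def regular_ideal_algebra_def
            annihilator_in_UNIV)
    show "is_boolean_algebra ?R" "is_boolean_algebra ?M"
      by (rule is_boolean_algebra_regular_ideals[OF U]
          is_boolean_algebra_invariant_regular_ideals[OF B])+
    show "bij_betw (\<lambda>J. J \<inter> B) (carrier ?R) (carrier ?M)"
      by (rule bij)
  qed (use cstar_subalgebra_zero_mem[OF B] in
      \<open>auto simp: invariant_regular_ideal_algebra_def regular_ideal_algebra_def\<close>)
  then show ?thesis
    using is_boolean_algebra_invariant_regular_ideals[OF B] recover exp by (simp add: carR carM)
qed

end
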